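(* Let $N\geq 1$ be an integer, let $L>0$, and let $f\colon\mathbb{R}^{d}\to\mathbb{R}$ be an $L$-smooth convex function with a minimizer $x_\star$. Then, for any starting point $x_0\in\mathbb{R}^d$, the final iterate $x_N$ of the lemniscate accelerated gradient method (defined in the context) satisfies $$\|\nabla f(x_N)\|^{2}\;\leq\;\frac{L^{2}\|x_{0}-x_{\star}\|^{2}}{\Omega_{N}^{2}}\;\leq\;\frac{\varpi^{4}L^{2}\|x_{0}-x_{\star}\|^{2}}{(N+1)^{4}},$$ where $\varpi=2\int_0^1\frac{dx}{\sqrt{1-x^{4}}}$ is the lemniscate constant.
   Context: $\mathbb{R}^d$ carries the standard inner product and Euclidean norm. A function is $L$-smooth if it is differentiable and its gradient is $L$-Lipschitz. For an integer $N\ge 0$, $\Omega_N>0$ denotes the unique positive real number for which there is a strictly decreasing nonnegative sequence $1=\rho_0>\rho_1>\cdots>\rho_{N+1}=0$ satisfying $$\Omega_N(\rho_k-\rho_{k+1})^2=\rho_k(1-\rho_{k+1}^2),\qquad k=0,\dots,N;$$ the sequence is then also unique, and $\rho_0,\dots,\rho_{N+1}$ denotes it (existence and uniqueness hold). Write $z^{+}=z-\frac1L\nabla f(z)$ for $z\in\mathbb{R}^d$. The lemniscate accelerated gradient method with iteration budget $N\ge1$, started at $x_0\in\mathbb{R}^d$ with $z_0=0$, is, for $k=0,1,\dots,N-1$, $$z_{k+1}=z_k-\Omega_N\left(\frac{1+\rho_{k+1}^2}{2\rho_{k+1}}-\frac{1+\rho_k^2}{2\rho_k}\right)\frac1L\nabla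 f(x_k),$$ $$x_{k+1}=x_k^{+}+\left(\frac{1+\rho_{k+1}^2}{1-\rho_{k+1}^2}-\frac{1+\rho_{k+2}^2}{1-\rho_{k+2}^2}\right)z_{k+1}.$$ *)

theory Defs
  imports "HOL-Analysis.Analysis"
begin

definition lemniscate_seq :: "nat \<Rightarrow> real \<Rightarrow> (nat \<Rightarrow> real) \<Rightarrow> bool" where
  "lemniscate_seq N w r \<longleftrightarrow>
     r 0 = 1 \<and> r (N + 1) = 0 \<and>
     (\<forall>k\<le>N + 1. 0 \<le> r k) \<and>
     (\<forall>k\<le>N. r (k + 1) < r k) \<and>
     (\<forall>k\<le>N. w * (r k - r (k + 1))\<^sup>2 = r k * (1 - (r (k + 1))\<^sup>2))"

definition Omega :: "nat \<Rightarrow> real" where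
  "Omega N = (THE w. 0 < w \<and> (\<exists>r. lemniscate_seq N w r))"

text \<open>The sequence is only meaningful at indices up to \<open>N + 1\<close>; it is extended by zero
  so that the definite description is unique as a function on all natural numbers.\<close>

definition rho :: "nat \<Rightarrow> nat \<Rightarrow> real" where
  "rho N = (THE r. lemniscate_seq N (Omega N) r \<and> (\<forall>k>N + 1. r k = 0))"

definition gradient :: "('a::euclidean_space \<Rightarrow> real) \<Rightarrow> 'a \<Rightarrow> 'a" where
  "gradient f x = (THE D. GDERIV f x :> D)"

definition smooth :: "real \<Rightarrow> ('a::euclidean_space \<Rightarrow> real) \<Rightarrow> bool" where
  "smooth L f \<longleftrightarrow> (\<forall>x. f differentiable (at x)) \<and> L-lipschitz_on UNIV (gradient f)"

definition gradient_step :: "real \<Rightarrow> ('a::euclidean_space \<Rightarrow> real) \<Rightarrow> 'a \<Rightarrow> 'a" where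
  "gradient_step L f z = z - (1 / L) *\<^sub>R gradient f z"

text \<open>The iterates are intended for \<open>k \<le> N\<close>; in that range only \<open>rho N 0, \<dots>, rho N (N + 1)\<close>
  are used and all denominators are nonzero.\<close>

fun agm_x agm_z ::
  "nat \<Rightarrow> real \<Rightarrow> ('a::euclidean_space \<Rightarrow> real) \<Rightarrow> 'a \<Rightarrow> nat \<Rightarrow> 'a" where
  "agm_x N L f x0 0 = x0"
| "agm_x N L f x0 (Suc k) =
     gradient_step L f (agm_x N L f x0 k) +
     ((1 + (rho N (k + 1))\<^sup>2) / (1 - (rho N (k + 1))\<^sup>2) -
      (1 + (rho N (k + 2))\<^sup>2) / (1 - (rho N (k + 2))\<^sup>2)) *\<^sub>R agm_z N L f x0 (Suc k)"
| "agm_z N L f x0 0 = 0"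
| "agm_z N L f x0 (Suc k) =
     agm_z N L f x0 k -
     (Omega N * ((1 + (rho N (k + 1))\<^sup>2) / (2 * rho N (k + 1)) -
                 (1 + (rho N k)\<^sup>2) / (2 * rho N k)) * (1 / L)) *\<^sub>R
     gradient f (agm_x N L f x0 k)"

definition lemniscate_const :: real where
  "lemniscate_const = 2 * integral {0..1} (\<lambda>x::real. 1 / sqrt (1 - x ^ 4))"

end

theory Submission
  imports Defs
begin

text \<open>
  Write \<open>F = f / L\<close> and \<open>G = \<nabla>f / L\<close>, let \<open>s\<close> be the minimizer, and abbreviate \<open>w = \<Omega>\<^sub>N\<close>,
  \<open>g\<^sub>k = G x\<^sub>k\<close>. Convexity and smoothness enter only through the inequality
  \<open>interp_gap F G x y \<ge> 0\<close>, that is, \<open>F x \<ge> F y + G y \<bullet> (x - y) + (norm (G x - G y))\<^sup>2 / 2\<close>,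
  and through \<open>G s = 0\<close>.

  The first inequality of the theorem comes from an exact certificate. Let
  \<open>u\<^sub>k = w (\<rho>\<^sub>k - \<rho>\<^sub>k\<^sub>+\<^sub>1)\<close>, let \<open>\<gamma>\<^sub>k\<close> be the coefficient of \<open>- g\<^sub>k\<close> in \<open>z\<^sub>k\<^sub>+\<^sub>1 - z\<^sub>k\<close>, and put
  \<open>y\<^sub>k = x\<^sub>0 - \<Sum>i<k. u\<^sub>i g\<^sub>i\<close>. The recursion for \<open>\<rho>\<close> is what makes the method equivalent to
  two plain accumulations of gradients: \<open>x\<^sub>k = y\<^sub>k - q\<^sub>k z\<^sub>k\<close>, with
  \<open>q\<^sub>k = 2 \<rho>\<^sub>k\<^sub>+\<^sub>1\<^sup>2 / (1 - \<rho>\<^sub>k\<^sub>+\<^sub>1\<^sup>2)\<close>. In particular \<open>x\<^sub>N = y\<^sub>N\<close>, because \<open>\<rho>\<^sub>N\<^sub>+\<^sub>1 = 0\<close>.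
  The certificate gives the gap of the pairs \<open>(s, x\<^sub>k)\<close>, \<open>(x\<^sub>k, x\<^sub>k\<^sub>+\<^sub>1)\<close> and \<open>(x\<^sub>N, x\<^sub>k)\<close> the weights
  \<open>2 u\<^sub>k\<close>, \<open>w (1 / \<rho>\<^sub>k\<^sub>+\<^sub>1 - \<rho>\<^sub>k\<^sub>+\<^sub>1)\<close> and \<open>2 \<gamma>\<^sub>k\<close>. The first two families are those of accelerated
  methods for decreasing the function value, the last one is that of methods for decreasing the
  gradient norm. The partial sums of the weighted gaps have the closed form \<open>energy\<close>
  (lemma \<open>energy_step\<close>), so \<open>energy\<close> never falls below its initial value \<open>- (norm (x\<^sub>0 - s))\<^sup>2\<close>.
  Since \<open>w \<rho>\<^sub>N = 1\<close>, the final energy contains only \<open>F x\<^sub>N - F s\<close>, \<open>norm g\<^sub>N\<close> and \<open>norm (x\<^sub>N - s)\<close>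
  (\<open>energy_final\<close>), and the gaps between \<open>x\<^sub>N\<close> and \<open>s\<close> turn it into
  \<open>w\<^sup>2 (norm g\<^sub>N)\<^sup>2 \<le> (norm (x\<^sub>0 - s))\<^sup>2\<close> (\<open>final_gradient_bound\<close>).

  The second inequality is \<open>N + 1 \<le> sqrt w \<cdot> \<varpi>\<close>. The recursion says that
  \<open>sqrt w (\<rho>\<^sub>k - \<rho>\<^sub>k\<^sub>+\<^sub>1) / sqrt (\<rho>\<^sub>k (1 - \<rho>\<^sub>k\<^sub>+\<^sub>1\<^sup>2)) = 1\<close>. Summed over \<open>k\<close>, the left-hand sides
  are bounded by \<open>sqrt w \<integral> d\<rho> / sqrt (\<rho> (1 - \<rho>\<^sup>2))\<close> over \<open>[0, 1]\<close>, which is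
  equal to \<open>sqrt w \<cdot> \<varpi>\<close> after \<open>\<rho> = x\<^sup>2\<close> (\<open>lemniscate_arc_lower\<close>, \<open>lemniscate_seq_lower\<close>).

  Both parts need \<open>\<Omega>\<^sub>N\<close> and \<open>\<rho>\<close> to satisfy their defining equations, that is, existence and
  uniqueness (\<open>Omega_rho\<close>). For fixed \<open>w\<close> the recursion determines \<open>\<rho>\<close> from \<open>\<rho>\<^sub>0 = 1\<close>, and \<open>\<rho>\<close> grows
  strictly with \<open>w\<close>, whence uniqueness; the intermediate value theorem, used in an induction on
  \<open>N\<close>, gives existence.
\<close>

section \<open>Gradients of smooth convex functions\<close>

lemma smooth_GDERIV:
  assumes "smooth L f"
  shows "GDERIV f x :> gradient f x"
proof -
  have "f differentiable (at x)"
    using assms by (simp add: smooth_def)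
  then obtain f' where f': "(f has_derivative f') (at x)"
    unfolding differentiable_def by blast
  \<comment> \<open>The Riesz representative of the derivative.\<close>
  define D where "D = (\<Sum>b\<in>Basis. f' b *\<^sub>R b)"
  have "f' h = h \<bullet> D" for h
  proof -
    interpret linear f' using f' by (rule has_derivative_linear)
    have "f' h = f' (\<Sum>b\<in>Basis. (h \<bullet> b) *\<^sub>R b)"
      by (simp add: euclidean_representation)
    also have "\<dots> = (\<Sum>b\<in>Basis. (h \<bullet> b) * f' b)"
      by (simp add: sum scale)
    finally show ?thesis
      by (simp add: D_def inner_sum_right mult.commute)
  qed
  then have "f' = (\<lambda>h. h \<bullet> D)"
    by blast
  then have "GDERIV f x :> D"
    using f' by (simp add: gderiv_def)
  moreover have "E = D" if "GDERIV f x :> E" for E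
  proof -
    have "(\<lambda>h. h \<bullet> E) = (\<lambda>h. h \<bullet> D)"
      using that \<open>GDERIV f x :> D\<close> unfolding gderiv_def by (rule has_derivative_unique)
    then show ?thesis
      by (metis vector_eq_ldot)
  qed
  ultimately show ?thesis
    unfolding gradient_def by (metis theI)
qed

lemma smooth_DERIV_line:
  assumes "smooth L f"
  shows "((\<lambda>t. f (x + t *\<^sub>R d)) has_real_derivative gradient f (x + t *\<^sub>R d) \<bullet> d) (at t)"
proof -
  have "(f has_derivative (\<lambda>h. h \<bullet> gradient f (x + t *\<^sub>R d))) (at (x + t *\<^sub>R d))"
    using smooth_GDERIV[OF assms] by (simp add: gderiv_def)
  moreover have "((\<lambda>t. x + t *\<^sub>R d) has_derivative (\<lambda>h. h *\<^sub>R d)) (at t)"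
    by (auto intro!: derivative_eq_intros)
  ultimately have "((\<lambda>t. f (x + t *\<^sub>R d)) has_derivative
      (\<lambda>h. (h *\<^sub>R d) \<bullet> gradient f (x + t *\<^sub>R d))) (at t)"
    by (rule has_derivative_compose[rotated])
  then show ?thesis
    by (simp add: has_field_derivative_def inner_commute mult_commute_abs)
qed

lemma smooth_upper_bound:
  assumes "smooth L f"
  shows "f y \<le> f x + gradient f x \<bullet> (y - x) + L / 2 * (norm (y - x))\<^sup>2"
proof -
  define d where "d = y - x"
  \<comment> \<open>The error of the quadratic model along the segment; its derivative is nonpositive because
    the gradient is \<open>L\<close>-Lipschitz.\<close>
  define \<psi> where
    "\<psi> t = f (x + t *\<^sub>R d) - t * (gradient f x \<bullet> d) - L / 2 * t\<^sup>2 * (norm d)\<^sup>2" for t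
  have "\<psi> 1 \<le> \<psi> 0"
  proof (rule DERIV_nonpos_imp_nonincreasing[of 0 1 \<psi>])
    fix t :: real
    assume t: "0 \<le> t" "t \<le> 1"
    let ?e = "gradient f (x + t *\<^sub>R d) \<bullet> d - gradient f x \<bullet> d - L * t * (norm d)\<^sup>2"
    have "(\<psi> has_real_derivative ?e) (at t)"
      unfolding \<psi>_def
      by (rule derivative_eq_intros smooth_DERIV_line[OF assms] refl | simp)+
    moreover have "?e \<le> 0"
    proof -
      have "(gradient f (x + t *\<^sub>R d) - gradient f x) \<bullet> d
          \<le> norm (gradient f (x + t *\<^sub>R d) - gradient f x) * norm d"
        by (rule norm_cauchy_schwarz)
      also have "norm (gradient f (x + t *\<^sub>R d) - gradient f x) \<le> L * norm (t *\<^sub>R d)"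
        using assms lipschitz_onD[of L UNIV "gradient f" "x + t *\<^sub>R d" x]
        by (simp add: smooth_def dist_norm)
      finally show ?thesis
        using t by (simp add: inner_diff_left power2_eq_square mult_right_mono mult.assoc)
    qed
    ultimately show "\<exists>y. (\<psi> has_real_derivative y) (at t) \<and> y \<le> 0"
      by blast
  qed simp
  then show ?thesis
    by (simp add: \<psi>_def d_def)
qed

lemma convex_above_tangent:
  assumes "smooth L f" "convex_on UNIV f"
  shows "f x + gradient f x \<bullet> (y - x) \<le> f y"
proof -
  define \<phi> where "\<phi> t = f (x + t *\<^sub>R (y - x))" for t
  have "convex_on UNIV \<phi>"
  proof (rule convex_onI)
    fix t a b :: real
    assume t: "0 < t" "t < 1"
    have "x + ((1 - t) *\<^sub>R a + t *\<^sub>R b) *\<^sub>R (y - x)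
        = (1 - t) *\<^sub>R (x + a *\<^sub>R (y - x)) + t *\<^sub>R (x + b *\<^sub>R (y - x))"
      by (simp add: algebra_simps)
    then show "\<phi> ((1 - t) *\<^sub>R a + t *\<^sub>R b) \<le> (1 - t) * \<phi> a + t * \<phi> b"
      unfolding \<phi>_def using convex_onD[OF assms(2)] t by simp
  qed simp
  moreover have "(\<phi> has_real_derivative gradient f x \<bullet> (y - x)) (at 0)"
    using smooth_DERIV_line[OF assms(1), of x "y - x" 0] unfolding \<phi>_def by simp
  ultimately have "\<phi> 1 - \<phi> 0 \<ge> gradient f x \<bullet> (y - x) * (1 - 0)"
    by (intro convex_on_imp_above_tangent[where A = UNIV]) auto
  then show ?thesis
    by (simp add: \<phi>_def)
qed

text \<open>
  A gradient step of length \<open>1 / L\<close> from \<open>x\<close> on the function \<open>f - gradient f y \<bullet> _\<close>, which is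
  minimal at \<open>y\<close>, decreases it by at least the quadratic term.
\<close>

lemma convex_smooth_interpolation:
  assumes "smooth L f" "convex_on UNIV f" "0 < L"
  shows "f y + gradient f y \<bullet> (x - y) + (norm (gradient f x - gradient f y))\<^sup>2 / (2 * L) \<le> f x"
proof -
  define e where "e = gradient f x - gradient f y"
  define p where "p = x - (1 / L) *\<^sub>R e"
  have "f y + gradient f y \<bullet> (p - y) \<le> f p"
    by (rule convex_above_tangent) fact+
  also have "f p \<le> f x + gradient f x \<bullet> (p - x) + L / 2 * (norm (p - x))\<^sup>2"
    by (rule smooth_upper_bound) fact
  finally have "f y + gradient f y \<bullet> (p - y)
    \<le> f x + gradient f x \<bullet> (p - x) + L / 2 * (norm (p - x))\<^sup>2" .
  moreover have "gradient f y \<bullet> (p - y)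
      = gradient f y \<bullet> (x - y) + gradient f y \<bullet> (p - x)"
    by (simp add: algebra_simps)
  moreover have "gradient f y \<bullet> (p - x) - gradient f x \<bullet> (p - x) = (norm e)\<^sup>2 / L"
  proof -
    have "gradient f y \<bullet> (p - x) - gradient f x \<bullet> (p - x) = - (e \<bullet> (p - x))"
      by (simp add: e_def inner_diff_left)
    then show ?thesis
      by (simp add: p_def power2_norm_eq_inner)
  qed
  moreover have "L / 2 * (norm (p - x))\<^sup>2 = (norm e)\<^sup>2 / (2 * L)"
    using \<open>0 < L\<close> by (simp add: p_def field_simps power2_eq_square)
  moreover have "(norm e)\<^sup>2 / L = 2 * ((norm e)\<^sup>2 / (2 * L))"
    by simp
  ultimately show ?thesis
    unfolding e_def[symmetric] by linarith
qed

text \<open>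
  Otherwise a gradient step from the minimizer would decrease \<open>f\<close>.
\<close>

lemma gradient_minimizer_eq_0:
  assumes "smooth L f" "0 < L" "\<forall>x. f s \<le> f x"
  shows "gradient f s = 0"
proof -
  let ?g = "gradient f s"
  have "f s \<le> f (s - (1 / L) *\<^sub>R ?g)"
    using assms(3) by blast
  also have "\<dots> \<le> f s - (norm ?g)\<^sup>2 / (2 * L)"
    using smooth_upper_bound[OF assms(1), of "s - (1 / L) *\<^sub>R ?g" s] \<open>0 < L\<close>
    by (simp add: power2_norm_eq_inner[symmetric] power_mult_distrib power_divide
        field_simps power2_eq_square)
  finally show ?thesis
    using \<open>0 < L\<close> by (simp add: field_simps)
qed

section \<open>Existence and uniqueness of the sequence\<close>

text \<open>
  The smaller root \<open>t\<close> of \<open>w (a - t)\<^sup>2 = a (1 - t\<^sup>2)\<close>, a quadratic equation in \<open>t\<close> with leading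
  coefficient \<open>w + a\<close>. For \<open>0 < a \<le> 1\<close> it is the only root below \<open>a\<close>, hence the successor of \<open>a\<close> in the sequence.
\<close>

definition lemniscate_step :: "real \<Rightarrow> real \<Rightarrow> real" where
  "lemniscate_step w a = (w * a - sqrt (a * (w * (1 - a\<^sup>2) + a))) / (w + a)"

fun lemniscate_iter :: "real \<Rightarrow> nat \<Rightarrow> real" where
  "lemniscate_iter w 0 = 1"
| "lemniscate_iter w (Suc k) = lemniscate_step w (lemniscate_iter w k)"

text \<open>
  Completing the square in \<open>t\<close>: the first summand on the right is the discriminant, and the second
  one vanishes on the roots. All comparisons of a number \<open>t\<close> with the smaller root reduce to it.
\<close>

lemma lemniscate_discriminant:
  fixes w a t :: real
  shows "(w * a - (w + a) * t)\<^sup>2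
    = a * (w * (1 - a\<^sup>2) + a) + (w + a) * (w * (a - t)\<^sup>2 - a * (1 - t\<^sup>2))"
  by (simp add: power2_eq_square algebra_simps)

lemma lemniscate_discriminant_ge:
  assumes "0 < w" "0 \<le> a" "a \<le> 1"
  shows "a \<le> sqrt (a * (w * (1 - a\<^sup>2) + a))"
proof (rule real_le_rsqrt)
  have "0 \<le> a * (w * (1 - a\<^sup>2))"
    using assms by (simp add: power_le_one)
  then show "a\<^sup>2 \<le> a * (w * (1 - a\<^sup>2) + a)"
    by (simp add: algebra_simps power2_eq_square)
qed

lemma lemniscate_step_root:
  assumes "0 < w" "0 \<le> a" "a \<le> 1"
  shows "w * (a - lemniscate_step w a)\<^sup>2 = a * (1 - (lemniscate_step w a)\<^sup>2)"
proof -
  let ?t = "lemniscate_step w a" and ?D = "a * (w * (1 - a\<^sup>2) + a)"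
  have "0 \<le> ?D"
    using assms by (simp add: power_le_one)
  moreover have "w * a - (w + a) * ?t = sqrt ?D"
    using assms by (simp add: lemniscate_step_def)
  ultimately have "(w * a - (w + a) * ?t)\<^sup>2 = ?D"
    by simp
  then have "(w + a) * (w * (a - ?t)\<^sup>2 - a * (1 - ?t\<^sup>2)) = 0"
    by (simp add: lemniscate_discriminant)
  then show ?thesis
    using assms by simp
qed

lemma lemniscate_step_less:
  assumes "0 < w" "0 < a" "a \<le> 1"
  shows "lemniscate_step w a < a"
proof -
  have "w * a - sqrt (a * (w * (1 - a\<^sup>2) + a)) \<le> w * a - a"
    using lemniscate_discriminant_ge[of w a] assms by simp
  also have "\<dots> < a * (w + a)"
    using assms by (simp add: algebra_simps) (metis add_pos_pos mult_pos_pos)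
  finally show ?thesis
    using assms by (simp add: lemniscate_step_def divide_less_eq)
qed

text \<open>
  A number below \<open>a\<close> is also below the larger root, since that root is at least \<open>a\<close>. This selects
  the sign when a square root is taken in the completed square.
\<close>

lemma lemniscate_step_branch:
  assumes "0 < w" "0 \<le> a" "a \<le> 1" "t < a"
  shows "- sqrt (a * (w * (1 - a\<^sup>2) + a)) < w * a - (w + a) * t"
proof -
  have "(w + a) * t < (w + a) * a"
    using assms by (intro mult_strict_left_mono) auto
  moreover have "a * a \<le> a"
    using assms by (simp add: mult_left_le)
  ultimately show ?thesis
    using lemniscate_discriminant_ge[of w a] assms by (simp add: algebra_simps)
qed

text \<open>
  The quadratic is nonnegative at \<open>t\<close>, so \<open>t\<close> does not lie strictly between the roots, and it is
  below the larger one.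
\<close>

lemma lemniscate_step_ge:
  assumes "0 < w" "0 \<le> a" "a \<le> 1" "t < a"
    and "a * (1 - t\<^sup>2) \<le> w * (a - t)\<^sup>2"
  shows "t \<le> lemniscate_step w a"
proof -
  let ?D = "a * (w * (1 - a\<^sup>2) + a)"
  have "?D \<le> (w * a - (w + a) * t)\<^sup>2"
    using assms by (simp add: lemniscate_discriminant)
  then have "sqrt ?D \<le> \<bar>w * a - (w + a) * t\<bar>"
    using real_sqrt_le_mono by fastforce
  then have "sqrt ?D \<le> w * a - (w + a) * t"
    using lemniscate_step_branch[OF assms(1-4)] by linarith
  then show ?thesis
    using assms by (simp add: lemniscate_step_def le_divide_eq algebra_simps)
qed

lemma lemniscate_step_unique:
  assumes "0 < w" "0 \<le> a" "a \<le> 1" "t < a"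
    and "w * (a - t)\<^sup>2 = a * (1 - t\<^sup>2)"
  shows "t = lemniscate_step w a"
proof -
  let ?D = "a * (w * (1 - a\<^sup>2) + a)"
  have "?D = (w * a - (w + a) * t)\<^sup>2"
    using assms by (simp add: lemniscate_discriminant)
  then have "sqrt ?D = \<bar>w * a - (w + a) * t\<bar>"
    by simp
  then have "sqrt ?D = w * a - (w + a) * t"
    using lemniscate_step_branch[OF assms(1-4)] by linarith
  then show ?thesis
    using assms by (simp add: lemniscate_step_def eq_divide_eq algebra_simps)
qed

text \<open>
  Monotonicity of the recursion in \<open>w\<close> and \<open>a\<close>: the quotient \<open>(a - t)\<^sup>2 / a\<close> increases with \<open>a\<close> for
  \<open>a > t\<close>. Together with \<open>lemniscate_step_ge\<close> this bounds the successor of \<open>a'\<close> for \<open>w'\<close> from below by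
  the successor \<open>t\<close> of \<open>a\<close> for \<open>w\<close>.
\<close>

lemma lemniscate_equation_mono:
  fixes w w' a a' t :: real
  assumes "w * (a - t)\<^sup>2 = a * (1 - t\<^sup>2)" "0 < w" "w \<le> w'" "0 \<le> t" "t < a" "a \<le> a'"
  shows "a' * (1 - t\<^sup>2) \<le> w' * (a' - t)\<^sup>2"
    and "w < w' \<Longrightarrow> a' * (1 - t\<^sup>2) < w' * (a' - t)\<^sup>2"
proof -
  have "t * t \<le> a * a'"
    using assms by (intro mult_mono) auto
  then have "0 \<le> (a' - a) * (a * a' - t * t)"
    using assms by simp
  then have "a' * (a - t)\<^sup>2 \<le> a * (a' - t)\<^sup>2"
    by (simp add: power2_eq_square algebra_simps)
  then have "w * (a' * (a - t)\<^sup>2) \<le> w * (a * (a' - t)\<^sup>2)"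
    using assms by simp
  moreover have "a * (a' * (1 - t\<^sup>2)) = w * (a' * (a - t)\<^sup>2)"
    using assms(1) by (metis mult.left_commute)
  ultimately have "a * (a' * (1 - t\<^sup>2)) \<le> a * (w * (a' - t)\<^sup>2)"
    by (simp add: algebra_simps)
  then have *: "a' * (1 - t\<^sup>2) \<le> w * (a' - t)\<^sup>2"
    using assms by simp
  also have "\<dots> \<le> w' * (a' - t)\<^sup>2"
    using assms by (simp add: mult_right_mono)
  finally show "a' * (1 - t\<^sup>2) \<le> w' * (a' - t)\<^sup>2" .
  show "a' * (1 - t\<^sup>2) < w' * (a' - t)\<^sup>2" if "w < w'"
  proof -
    have "w * (a' - t)\<^sup>2 < w' * (a' - t)\<^sup>2"
      using that assms by (intro mult_strict_right_mono) auto
    with * show ?thesis by linarith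
  qed
qed

lemma lemniscate_seq_eq_iter:
  assumes "lemniscate_seq N w r" "0 < w" "k \<le> N + 1"
  shows "r k = lemniscate_iter w k \<and> r k \<le> 1"
  using assms(3)
proof (induction k)
  case 0
  then show ?case
    using assms by (simp add: lemniscate_seq_def)
next
  case (Suc k)
  have r: "r (Suc k) < r k" "w * (r k - r (Suc k))\<^sup>2 = r k * (1 - (r (Suc k))\<^sup>2)" "0 \<le> r k"
    using assms(1) Suc.prems by (auto simp: lemniscate_seq_def)
  have IH: "r k = lemniscate_iter w k" "r k \<le> 1"
    using Suc by auto
  have "r (Suc k) = lemniscate_step w (r k)"
    using \<open>0 < w\<close> r IH(2) by (intro lemniscate_step_unique)
  then show ?case
    using IH r(1) by auto
qed

lemma lemniscate_seq_strict_mono: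
  assumes "lemniscate_seq N w r" "lemniscate_seq N w' r'" "0 < w" "w < w'" "k \<le> N"
  shows "r (k + 1) < r' (k + 1)"
proof -
  have step: "r (k + 1) < r' (k + 1)" if "k \<le> N" "r k \<le> r' k" for k
  proof -
    have r: "r (k + 1) < r k" "w * (r k - r (k + 1))\<^sup>2 = r k * (1 - (r (k + 1))\<^sup>2)"
      "0 \<le> r (k + 1)"
      using that assms by (auto simp: lemniscate_seq_def)
    then have less: "r' k * (1 - (r (k + 1))\<^sup>2) < w' * (r' k - r (k + 1))\<^sup>2"
      using that assms by (intro lemniscate_equation_mono(2)[of w "r k"]) auto
    have r': "r' k \<le> 1" "r' (k + 1) = lemniscate_step w' (r' k)"
      using lemniscate_seq_eq_iter[OF assms(2), of k] lemniscate_seq_eq_iter[OF assms(2), of "k + 1"]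
        that assms by auto
    then have "r (k + 1) \<le> r' (k + 1)"
      using r less that assms by (auto intro!: lemniscate_step_ge)
    moreover have "r (k + 1) \<noteq> r' (k + 1)"
      using less that assms(2) by (auto simp: lemniscate_seq_def)
    ultimately show ?thesis by simp
  qed
  show ?thesis
    using assms(5)
  proof (induction k)
    case 0
    then show ?case
      using step[of 0] assms by (simp add: lemniscate_seq_def)
  next
    case (Suc k)
    then show ?case
      using step[of "Suc k"] by simp
  qed
qed

text \<open>
  By strict monotonicity, two sequences with different parameters cannot both end in \<open>0\<close>.
\<close>

lemma lemniscate_seq_unique:
  assumes "lemniscate_seq N w r" "lemniscate_seq N w' r'" "0 < w" "0 < w'"
  shows "w = w'"
proof -
  have "r (N + 1) = r' (N + 1)"
    using assms by (simp add: lemniscate_seq_def)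
  then show ?thesis
    using lemniscate_seq_strict_mono[OF assms(1,2), of N]
      lemniscate_seq_strict_mono[OF assms(2,1), of N] assms(3,4)
    by force
qed

lemma lemniscate_iter_mono:
  assumes "0 < w" "w \<le> w'" "\<forall>k\<le>N. 0 < lemniscate_iter w k" "k \<le> N"
  shows "lemniscate_iter w k \<le> lemniscate_iter w' k \<and> lemniscate_iter w k \<le> 1 \<and> lemniscate_iter w' k \<le> 1"
  using assms(4)
proof (induction k)
  case (Suc k)
  let ?a = "lemniscate_iter w k" and ?a' = "lemniscate_iter w' k"
  have IH: "?a \<le> ?a'" "?a \<le> 1" "?a' \<le> 1" and pos: "0 < ?a" "0 < lemniscate_step w ?a"
    using Suc assms(3) by (auto dest: spec[of _ "Suc k"])
  then have less: "lemniscate_step w ?a < ?a" "lemniscate_step w' ?a' < ?a'"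
    using assms by (auto intro!: lemniscate_step_less)
  have "?a' * (1 - (lemniscate_step w ?a)\<^sup>2) \<le> w' * (?a' - lemniscate_step w ?a)\<^sup>2"
    using IH pos less assms by (intro lemniscate_equation_mono(1)[OF lemniscate_step_root]) auto
  then have "lemniscate_step w ?a \<le> lemniscate_step w' ?a'"
    using IH pos less assms by (intro lemniscate_step_ge) auto
  then show ?case
    using IH less by simp
qed simp

text \<open>
  One step decreases the iterate by at most \<open>1 / sqrt w\<close>, since the quadratic is nonnegative at
  \<open>t = a - 1 / sqrt w\<close>. Hence the iterates stay away from \<open>0\<close> for large \<open>w\<close>.
\<close>

lemma lemniscate_iter_lower:
  assumes "0 < w" "real k \<le> sqrt w"
  shows "1 - real k / sqrt w \<le> lemniscate_iter w k \<and> lemniscate_iter w k \<le> 1"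
  using assms(2)
proof (induction k)
  case (Suc k)
  let ?a = "lemniscate_iter w k" and ?t = "lemniscate_iter w k - 1 / sqrt w"
  have a: "1 - real k / sqrt w \<le> ?a" "?a \<le> 1"
    using Suc by auto
  have "real k / sqrt w < 1"
    using Suc.prems assms by simp
  then have pos: "0 < ?a"
    using a by linarith
  have "?a * (1 - ?t\<^sup>2) \<le> ?a * 1"
    using pos by (intro mult_left_mono) auto
  also have "\<dots> \<le> w * (?a - ?t)\<^sup>2"
    using a assms by (simp add: power_divide)
  finally have "?t \<le> lemniscate_step w ?a"
    using a pos assms by (intro lemniscate_step_ge) auto
  moreover have "lemniscate_step w ?a < ?a"
    using a pos assms by (intro lemniscate_step_less)
  ultimately show ?case
    using a by (simp add: add_divide_distrib)
qed simp

text \<open>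
  If the \<open>N\<close>-th iterate is \<open>a > 0\<close>, the next term \<open>0\<close> satisfies the recursion exactly if \<open>w a = 1\<close>.
  Let \<open>w0\<close> be the solution for \<open>N\<close>. At \<open>w0\<close> the iterate with index \<open>N + 1\<close> is \<open>0\<close>, and for large \<open>w\<close>
  it is at least \<open>1 / 2\<close>; in between, \<open>w\<close> times this iterate takes the value \<open>1\<close>. Starting the
  interval at \<open>w0\<close> keeps all earlier iterates positive, by monotonicity in \<open>w\<close>.
\<close>

lemma lemniscate_iter_exists:
  "\<exists>w>0. (\<forall>k\<le>N. 0 < lemniscate_iter w k) \<and> w * lemniscate_iter w N = 1"
proof (induction N)
  case 0
  show ?case by (intro exI[of _ 1]) simp
next
  case (Suc N)
  then obtain w0 where w0: "0 < w0" "\<forall>k\<le>N. 0 < lemniscate_iter w0 k" "w0 * lemniscate_iter w0 N = 1"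
    by blast
  \<comment> \<open>Large enough for the iterate with index \<open>N + 1\<close> to be at least \<open>1 / 2\<close>.\<close>
  define W where "W = max w0 ((2 * (real N + 2))\<^sup>2)"
  have W: "w0 \<le> W" "2 * (real N + 2) \<le> sqrt W" "1 \<le> W / 2"
  proof -
    show "w0 \<le> W" by (simp add: W_def)
    have le: "(2 * (real N + 2))\<^sup>2 \<le> W" by (simp add: W_def)
    then show "2 * (real N + 2) \<le> sqrt W"
      by (rule real_le_rsqrt)
    have "2\<^sup>2 \<le> (2 * (real N + 2))\<^sup>2"
      by (intro power_mono) auto
    with le show "1 \<le> W / 2" by simp
  qed
  have pos: "0 < lemniscate_iter w k \<and> lemniscate_iter w k \<le> 1" if "w0 \<le> w" "k \<le> N" for w k
    using lemniscate_iter_mono[OF w0(1) that(1) w0(2) that(2)] w0(2) that(2) by force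
  have cont: "continuous_on {w0..W} (\<lambda>w. lemniscate_iter w k)" if "k \<le> Suc N" for k
    using that
  proof (induction k)
    case (Suc k)
    have "w + lemniscate_iter w k \<noteq> 0" if "w \<in> {w0..W}" for w
      using pos[of w k] that w0 Suc.prems by auto
    moreover have "continuous_on {w0..W} (\<lambda>w. lemniscate_iter w k)"
      using Suc by simp
    ultimately show ?case
      by (auto simp: lemniscate_step_def intro!: continuous_intros)
  qed simp
  have "\<exists>w\<ge>w0. w \<le> W \<and> w * lemniscate_iter w (Suc N) = 1"
  proof (rule IVT')
    have inv: "lemniscate_iter w0 N = 1 / w0"
      using w0 by (simp add: field_simps)
    then have "lemniscate_iter w0 (Suc N) = 0"
      using w0 by (simp add: lemniscate_step_def power2_eq_square field_simps)
    then show "w0 * lemniscate_iter w0 (Suc N) \<le> 1"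
      by simp
    have "1 - real (Suc N) / sqrt W \<le> lemniscate_iter W (Suc N)"
      using lemniscate_iter_lower[of W "Suc N"] W w0 by simp
    moreover have "real (Suc N) / sqrt W \<le> 1 / 2"
      using W(2,3) by (subst divide_le_eq) auto
    ultimately have "1 / 2 \<le> lemniscate_iter W (Suc N)"
      by linarith
    then have "W * (1 / 2) \<le> W * lemniscate_iter W (Suc N)"
      using W(3) by (intro mult_left_mono) auto
    with W(3) show "1 \<le> W * lemniscate_iter W (Suc N)"
      by linarith
    show "w0 \<le> W" by fact
    show "continuous_on {w0..W} (\<lambda>w. w * lemniscate_iter w (Suc N))"
      by (intro continuous_intros cont) simp
  qed
  then obtain w where w: "w0 \<le> w" "w * lemniscate_iter w (Suc N) = 1"
    by blast
  then have "0 < w" using w0 by simp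
  then have "0 < lemniscate_iter w (Suc N)"
    using w(2) by (metis zero_less_mult_pos zero_less_one)
  then have "0 < lemniscate_iter w k" if "k \<le> Suc N" for k
    using pos[OF w(1), of k] that by (cases "k = Suc N") auto
  with w \<open>0 < w\<close> show ?case
    by blast
qed

lemma lemniscate_seq_exists: "\<exists>w r. 0 < w \<and> lemniscate_seq N w r"
proof -
  obtain w where w: "0 < w" "\<forall>k\<le>N. 0 < lemniscate_iter w k" "w * lemniscate_iter w N = 1"
    using lemniscate_iter_exists by blast
  define r where "r k = (if k \<le> N then lemniscate_iter w k else 0)" for k
  have le: "lemniscate_iter w k \<le> 1" if "k \<le> N" for k
    using lemniscate_iter_mono[OF w(1) order_refl w(2) that] by simp
  have "r (k + 1) < r k \<and> w * (r k - r (k + 1))\<^sup>2 = r k * (1 - (r (k + 1))\<^sup>2)" if "k \<le> N" for k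
  proof (cases "k = N")
    case True
    then show ?thesis
      using w by (simp add: r_def power2_eq_square)
  next
    case False
    then show ?thesis
      using that w le[of k] lemniscate_step_root[of w "lemniscate_iter w k"]
        lemniscate_step_less[of w "lemniscate_iter w k"]
      by (simp add: r_def less_imp_le)
  qed
  then have "lemniscate_seq N w r"
    using w by (auto simp: lemniscate_seq_def r_def less_imp_le)
  with w show ?thesis by blast
qed

lemma Omega_rho: "0 < Omega N" "lemniscate_seq N (Omega N) (rho N)"
proof -
  have "\<exists>!w. 0 < w \<and> (\<exists>r. lemniscate_seq N w r)"
    using lemniscate_seq_exists[of N] lemniscate_seq_unique by blast
  then have "0 < Omega N \<and> (\<exists>r. lemniscate_seq N (Omega N) r)"
    unfolding Omega_def by (rule theI')
  then have \<Omega>: "0 < Omega N" "\<exists>r. lemniscate_seq N (Omega N) r"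
    by auto
  then obtain r where r: "lemniscate_seq N (Omega N) r"
    by blast
  have "\<exists>!r. lemniscate_seq N (Omega N) r \<and> (\<forall>k>N + 1. r k = 0)"
  proof (rule ex1I)
    show "lemniscate_seq N (Omega N) (\<lambda>k. if k \<le> N + 1 then r k else 0) \<and>
        (\<forall>k>N + 1. (if k \<le> N + 1 then r k else 0) = 0)"
      using r by (simp add: lemniscate_seq_def)
  next
    fix r'
    assume r': "lemniscate_seq N (Omega N) r' \<and> (\<forall>k>N + 1. r' k = 0)"
    show "r' = (\<lambda>k. if k \<le> N + 1 then r k else 0)"
      using lemniscate_seq_eq_iter[OF r \<Omega>(1)] lemniscate_seq_eq_iter[of N _ r', OF _ \<Omega>(1)] r'
      by auto
  qed
  then show "lemniscate_seq N (Omega N) (rho N)"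
    unfolding rho_def by (rule theI'[THEN conjunct1])
  show "0 < Omega N" by fact
qed

section \<open>Comparison with the lemniscate constant\<close>

text \<open>
  The integrand is unbounded at \<open>1\<close>, but it is dominated by the derivative of \<open>arcsin\<close>.
\<close>

lemma lemniscate_integrand_integrable:
  "(\<lambda>x::real. 1 / sqrt (1 - x ^ 4)) integrable_on {0..1}"
proof (rule measurable_bounded_by_integrable_imp_integrable)
  show "(\<lambda>x::real. 1 / sqrt (1 - x ^ 4)) \<in> borel_measurable (lebesgue_on {0..1})"
    by (intro measurable_restrict_space1 measurable_completion) measurable
  have "((\<lambda>x. 1 / sqrt (1 - x\<^sup>2)) has_integral (arcsin 1 - arcsin 0)) {0..1}"
  proof (rule fundamental_theorem_of_calculus_interior)
    fix x :: real
    assume "x \<in> {0<..<1}"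
    then show "(arcsin has_vector_derivative 1 / sqrt (1 - x\<^sup>2)) (at x)"
      using DERIV_arcsin[of x]
      by (simp add: has_real_derivative_iff_has_vector_derivative inverse_eq_divide)
  qed (auto intro!: continuous_on_arcsin' continuous_intros)
  then show "(\<lambda>x::real. 1 / sqrt (1 - x\<^sup>2)) integrable_on {0..1}"
    by blast
  fix x :: real
  assume x: "x \<in> {0..1}"
  show "norm (1 / sqrt (1 - x ^ 4)) \<le> 1 / sqrt (1 - x\<^sup>2)"
  proof (cases "x = 1")
    case False
    then have "x\<^sup>2 < 1" and le: "x ^ 4 \<le> x\<^sup>2"
      using x by (auto simp: power2_less_1_iff abs_if intro!: power_decreasing)
    then show ?thesis
      by (auto intro!: divide_left_mono mult_pos_pos)
  qed simp
qed auto

lemma sqrt_power4: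
  assumes "0 \<le> a"
  shows "sqrt a ^ 4 = a\<^sup>2"
proof -
  have "sqrt a ^ 4 = ((sqrt a)\<^sup>2)\<^sup>2"
    by (simp flip: power_mult)
  then show ?thesis
    using assms by simp
qed

text \<open>
  On the interval the integrand is at least its value \<open>1 / sqrt (1 - b\<^sup>2)\<close> at the left end, and the
  length \<open>sqrt a - sqrt b\<close> is at least \<open>(a - b) / (2 sqrt a)\<close>. By the recursion the product of these
  two bounds is \<open>1 / (2 sqrt w)\<close>.
\<close>

lemma lemniscate_arc_lower:
  fixes w a b :: real
  assumes eq: "w * (a - b)\<^sup>2 = a * (1 - b\<^sup>2)" and "0 < w" "0 \<le> b" "b < a" "a \<le> 1"
  shows "1 / (2 * sqrt w) \<le> integral {sqrt b..sqrt a} (\<lambda>x. 1 / sqrt (1 - x ^ 4))"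
proof -
  have b1: "b\<^sup>2 < 1"
    using assms by (simp add: power2_less_1_iff)
  have "(sqrt w * (a - b))\<^sup>2 = (sqrt a * sqrt (1 - b\<^sup>2))\<^sup>2"
    using assms b1 by (simp add: power_mult_distrib)
  then have root: "sqrt w * (a - b) = sqrt a * sqrt (1 - b\<^sup>2)"
    using assms b1 by (subst (asm) power2_eq_iff_nonneg) auto
  have "(sqrt a - sqrt b) * (sqrt a + sqrt b) = a - b"
    using assms by (simp add: algebra_simps)
  moreover have "(sqrt a - sqrt b) * (sqrt a + sqrt b) \<le> (sqrt a - sqrt b) * (2 * sqrt a)"
    using assms by (intro mult_left_mono) auto
  ultimately have ab: "a - b \<le> 2 * sqrt a * (sqrt a - sqrt b)"
    by (simp add: algebra_simps)
  have "1 / (2 * sqrt w) = (a - b) / (2 * sqrt a) / sqrt (1 - b\<^sup>2)"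
    using root assms b1 by (simp add: field_simps)
  also have "\<dots> \<le> (sqrt a - sqrt b) / sqrt (1 - b\<^sup>2)"
    using ab assms b1 by (intro divide_right_mono) (auto simp: field_simps)
  also have "\<dots> = integral {sqrt b..sqrt a} (\<lambda>x. 1 / sqrt (1 - b\<^sup>2))"
    using assms by simp
  \<comment> \<open>At \<open>x = 1\<close> the integrand is \<open>1 / 0 = 0\<close>, which violates the pointwise bound, so this point is
    removed from the interval.\<close>
  also have "\<dots> = integral ({sqrt b..sqrt a} - {1}) (\<lambda>x. 1 / sqrt (1 - b\<^sup>2))"
    by (rule integral_spike_set) (auto intro: negligible_subset[of "{1}"])
  also have "\<dots> \<le> integral ({sqrt b..sqrt a} - {1}) (\<lambda>x. 1 / sqrt (1 - x ^ 4))"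
  proof (rule integral_le)
    have "(\<lambda>x. 1 / sqrt (1 - x ^ 4)) integrable_on {sqrt b..sqrt a}"
      using assms by (intro integrable_subinterval_real[OF lemniscate_integrand_integrable]) auto
    then show "(\<lambda>x. 1 / sqrt (1 - x ^ 4)) integrable_on {sqrt b..sqrt a} - {1}"
      by (rule integrable_spike_set) (auto intro: negligible_subset[of "{1}"])
    have "(\<lambda>x. 1 / sqrt (1 - b\<^sup>2)) integrable_on {sqrt b..sqrt a}"
      by (rule integrable_const_ivl)
    then show "(\<lambda>x. 1 / sqrt (1 - b\<^sup>2)) integrable_on {sqrt b..sqrt a} - {1}"
      by (rule integrable_spike_set) (auto intro: negligible_subset[of "{1}"])
  next
    fix x
    assume x: "x \<in> {sqrt b..sqrt a} - {1}"
    have "0 \<le> x" "x < 1"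
    proof -
      show "0 \<le> x"
        using x assms by (meson DiffD1 atLeastAtMost_iff order_trans real_sqrt_ge_zero)
      have "sqrt a \<le> 1" using assms by simp
      moreover have "x \<le> sqrt a" "x \<noteq> 1" using x by auto
      ultimately show "x < 1" by linarith
    qed
    then have "x ^ 4 < 1"
      by (simp add: power_less_one_iff)
    moreover have "b\<^sup>2 \<le> x ^ 4"
      using power_mono[of "sqrt b" x 4] x assms by (simp add: sqrt_power4)
    ultimately show "1 / sqrt (1 - b\<^sup>2) \<le> 1 / sqrt (1 - x ^ 4)"
      by (auto intro!: divide_left_mono mult_pos_pos)
  qed
  also have "\<dots> = integral {sqrt b..sqrt a} (\<lambda>x. 1 / sqrt (1 - x ^ 4))"
    by (rule integral_spike_set) (auto intro: negligible_subset[of "{1}"])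
  finally show ?thesis .
qed

lemma lemniscate_seq_lower:
  assumes "lemniscate_seq N w r" "0 < w"
  shows "real (N + 1) \<le> sqrt w * lemniscate_const"
proof -
  let ?F = "\<lambda>x::real. 1 / sqrt (1 - x ^ 4)"
  have "real k / (2 * sqrt w) \<le> integral {sqrt (r k)..1} ?F \<and> r k \<le> 1" if "k \<le> N + 1" for k
    using that
  proof (induction k)
    case 0
    then show ?case
      using assms by (simp add: lemniscate_seq_def)
  next
    case (Suc k)
    then have IH: "real k / (2 * sqrt w) \<le> integral {sqrt (r k)..1} ?F" "r k \<le> 1"
      by auto
    have r: "w * (r k - r (Suc k))\<^sup>2 = r k * (1 - (r (Suc k))\<^sup>2)"
      "0 \<le> r (Suc k)" "r (Suc k) < r k"
      using Suc.prems assms(1) by (auto simp: lemniscate_seq_def)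
    have "1 / (2 * sqrt w) \<le> integral {sqrt (r (Suc k))..sqrt (r k)} ?F"
      using r IH assms by (intro lemniscate_arc_lower) auto
    moreover have "integral {sqrt (r (Suc k))..sqrt (r k)} ?F + integral {sqrt (r k)..1} ?F
        = integral {sqrt (r (Suc k))..1} ?F"
      using r IH
      by (intro Henstock_Kurzweil_Integration.integral_combine
          integrable_subinterval_real[OF lemniscate_integrand_integrable]) auto
    ultimately show ?case
      using IH r by (simp add: add_divide_distrib)
  qed
  from this[of "N + 1"] have "real (N + 1) / (2 * sqrt w) \<le> integral {0..1} ?F"
    using assms(1) by (simp add: lemniscate_seq_def)
  then show ?thesis
    using \<open>0 < w\<close> by (simp add: lemniscate_const_def field_simps)
qed

section \<open>The energy of the method\<close>

definition interp_gap :: "('a::real_inner \<Rightarrow> real) \<Rightarrow> ('a \<Rightarrow> 'a) \<Rightarrow> 'a \<Rightarrow> 'a \<Rightarrow> real" where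
  "interp_gap F G x y = F x - F y - G y \<bullet> (x - y) - (norm (G x - G y))\<^sup>2 / 2"

text \<open>
  The sum of \<open>- (norm (x\<^sub>0 - s))\<^sup>2\<close> and the weighted gaps accumulated up to the current step,
  expressed by the current state alone: \<open>a\<close> is the current \<open>\<rho>\<close>, \<open>x\<close> and \<open>z\<close> are the iterates, and \<open>y\<close>
  is the auxiliary point reached from \<open>x\<^sub>0\<close> by the weighted gradients. The point \<open>p\<close> is the final
  iterate; it enters already during the iteration, through the gaps between \<open>p\<close> and each iterate.
\<close>

definition energy :: "('a::real_inner \<Rightarrow> real) \<Rightarrow> ('a \<Rightarrow> 'a) \<Rightarrow> real \<Rightarrow> 'a \<Rightarrow> 'a
    \<Rightarrow> real \<Rightarrow> 'a \<Rightarrow> 'a \<Rightarrow> 'a \<Rightarrow> real" where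
  "energy F G w s p a x y z =
     2 * w * (1 - a) * F s + w * (1 / a + a - 2) * (F p - (norm (G p))\<^sup>2 / 2)
     - w * (1 / a - a) * (F x + (norm (G x))\<^sup>2 / 2 - (x - y) \<bullet> G x)
     + 2 * w * a * (z \<bullet> G x) + 2 * (z \<bullet> (p - G p - y)) - (norm (y - s))\<^sup>2"

text \<open>
  All that the certificate uses about \<open>\<rho>\<close>: relations between the step sizes \<open>u\<close>, \<open>\<gamma>\<close>, the coefficient
  \<open>q\<close> in \<open>x = y - q z\<close>, and the weight \<open>w (1 / b - b)\<close> of the gap between successive iterates. The
  first one lets the relation between \<open>x\<close>, \<open>y\<close> and \<open>z\<close> survive a gradient step; the second one makes
  the terms in \<open>(norm (G x))\<^sup>2\<close> cancel, and the third one the terms in \<open>z \<bullet> G x\<close>. The last one gives the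
  increments of the coefficients of \<open>F p\<close> and \<open>F x\<close> in the energy.
\<close>

lemma lemniscate_scalars:
  fixes w a b :: real
  assumes eq: "w * (a - b)\<^sup>2 = a * (1 - b\<^sup>2)" and b: "0 < b" "b < a" "a \<le> 1"
  defines "u \<equiv> w * (a - b)"
    and "\<gamma> \<equiv> w * ((1 + b\<^sup>2) / (2 * b) - (1 + a\<^sup>2) / (2 * a))"
    and "q \<equiv> 2 * b\<^sup>2 / (1 - b\<^sup>2)"
  shows "u = 1 + \<gamma> * q" and "u * (u + 2 * \<gamma>) = w * (1 / b - b)"
    and "w * (1 / b - b) * q = 2 * w * b"
    and "2 * \<gamma> = w * (1 / b + b) - w * (1 / a + a)"
proof -
  have nz: "a \<noteq> 0" "b \<noteq> 0" "a - b \<noteq> 0" "1 - b\<^sup>2 \<noteq> 0"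
    using b by (auto simp: power2_eq_1_iff)
  have w: "w = a * (1 - b\<^sup>2) / (a - b)\<^sup>2"
    using eq nz by (simp add: field_simps)
  have \<gamma>: "\<gamma> = w * ((a - b) * (1 - a * b) / (2 * a * b))"
    unfolding \<gamma>_def using nz by (simp add: field_simps power2_eq_square)
  have u: "u = a * (1 - b\<^sup>2) / (a - b)"
    unfolding u_def w using nz by (simp add: power2_eq_square)
  have "\<gamma> = (1 - b\<^sup>2) * (1 - a * b) / (2 * b * (a - b))"
    unfolding \<gamma> w using nz by (simp add: power2_eq_square)
  then have "\<gamma> * q = b * (1 - a * b) / (a - b)"
    unfolding q_def using nz by (simp add: power2_eq_square)
  then show "u = 1 + \<gamma> * q"
    unfolding u using nz by (simp add: field_simps power2_eq_square)
  have "u + 2 * \<gamma> = w * ((a - b) / (a * b))"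
    unfolding \<gamma> u_def using nz by (simp add: field_simps)
  then have "u * (u + 2 * \<gamma>) = w * (w * (a - b)\<^sup>2) / (a * b)"
    by (simp add: u_def power2_eq_square)
  also have "\<dots> = w * (1 / b - b)"
    unfolding eq using nz by (simp add: field_simps power2_eq_square)
  finally show "u * (u + 2 * \<gamma>) = w * (1 / b - b)" .
  show "w * (1 / b - b) * q = 2 * w * b"
    unfolding q_def using nz by (simp add: field_simps power2_eq_square)
  show "2 * \<gamma> = w * (1 / b + b) - w * (1 / a + a)"
    unfolding \<gamma>_def using nz by (simp add: field_simps power2_eq_square)
qed

text \<open>
  The next iterate \<open>x'\<close> is arbitrary here: only the terms that contain \<open>x'\<close>, \<open>F x'\<close> or \<open>G x'\<close> involve
  it, and by the first conclusion these terms already combine to the gap between \<open>x\<close> and \<open>x'\<close>. The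
  choice of \<open>x'\<close> by the method matters only for restoring the relation between \<open>x\<close>, \<open>y\<close> and \<open>z\<close> with
  the next value of \<open>q\<close>.
\<close>

lemma energy_step:
  fixes w a b :: real
  assumes eq: "w * (a - b)\<^sup>2 = a * (1 - b\<^sup>2)" and b: "0 < b" "b < a" "a \<le> 1"
    and Gs: "G s = 0"
  defines "u \<equiv> w * (a - b)"
    and "\<gamma> \<equiv> w * ((1 + b\<^sup>2) / (2 * b) - (1 + a\<^sup>2) / (2 * a))"
    and "q \<equiv> 2 * b\<^sup>2 / (1 - b\<^sup>2)"
  assumes x: "x = y - q *\<^sub>R z"
  defines "y' \<equiv> y - u *\<^sub>R G x" and "z' \<equiv> z - \<gamma> *\<^sub>R G x"
  shows "x - G x = y' - q *\<^sub>R z'"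
    and "energy F G w s p b x' y' z' - energy F G w s p a x y z
      = 2 * u * interp_gap F G s x + w * (1 / b - b) * interp_gap F G x x'
        + 2 * \<gamma> * interp_gap F G p x"
proof -
  note sc = lemniscate_scalars[OF eq b, folded u_def \<gamma>_def q_def]
  define A A' where "A = w * (1 / a - a)" and "A' = w * (1 / b - b)"
  have A'A: "A' = A + 2 * u + 2 * \<gamma>" and A'q: "A' * q = 2 * w * b" and A'u: "A' = u * u + 2 * u * \<gamma>"
    and wa: "w * a = w * b + u"
    using sc by (simp_all add: A_def A'_def u_def algebra_simps)
  have u: "u = 1 + \<gamma> * q" by (rule sc)
  show xg: "x - G x = y' - q *\<^sub>R z'"
    by (simp add: x y'_def z'_def u algebra_simps)
  have xy': "x' - y' = (x' - x) + G x - q *\<^sub>R z'"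
    using xg by (simp add: algebra_simps)
  \<comment> \<open>The terms that contain the next iterate.\<close>
  have 1: "2 * w * b * (z' \<bullet> G x') - A' * (F x' + (norm (G x'))\<^sup>2 / 2 - (x' - y') \<bullet> G x')
      = A' * interp_gap F G x x' - A' * F x + A' * (norm (G x))\<^sup>2 / 2"
    unfolding xy' interp_gap_def A'q[symmetric] power2_norm_eq_inner
    by (simp add: inner_diff_left inner_diff_right inner_add_left inner_commute algebra_simps
        add_divide_distrib diff_divide_distrib)
  have y: "y = x + q *\<^sub>R z"
    by (simp add: x)
  \<comment> \<open>The remaining inner products. The coefficient of \<open>z \<bullet> G x\<close> vanishes.\<close>
  have "2 * (z' \<bullet> (p - G p - y')) - (norm (y' - s))\<^sup>2
      - (2 * (z \<bullet> (p - G p - y)) - (norm (y - s))\<^sup>2)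
      - 2 * w * a * (z \<bullet> G x) - A * ((x - y) \<bullet> G x)
      = 2 * u * (G x \<bullet> (x - s)) + 2 * \<gamma> * (G x \<bullet> (x - p)) + 2 * \<gamma> * (G p \<bullet> G x)
        - (u * u + 2 * u * \<gamma>) * (G x \<bullet> G x)
        + ((2 * u + 2 * \<gamma> + A) * q + 2 * u - 2 * (w * a)) * (z \<bullet> G x)"
    unfolding y'_def z'_def y power2_norm_eq_inner
    by (simp add: inner_diff_left inner_diff_right inner_add_left inner_add_right
        inner_commute algebra_simps)
  also have "(2 * u + 2 * \<gamma> + A) * q + 2 * u - 2 * (w * a) = 0"
    using A'q A'A wa by (simp add: algebra_simps)
  finally have 2: "2 * (z' \<bullet> (p - G p - y')) - (norm (y' - s))\<^sup>2
      - (2 * (z \<bullet> (p - G p - y)) - (norm (y - s))\<^sup>2)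
      - 2 * w * a * (z \<bullet> G x) - A * ((x - y) \<bullet> G x)
      = 2 * u * (G x \<bullet> (x - s)) + 2 * \<gamma> * (G x \<bullet> (x - p)) + 2 * \<gamma> * (G p \<bullet> G x)
        - A' * (norm (G x))\<^sup>2"
    by (simp add: A'u power2_norm_eq_inner)
  define P where "P = F p - (norm (G p))\<^sup>2 / 2"
  have 3: "2 * u * interp_gap F G s x + 2 * \<gamma> * interp_gap F G p x
      = 2 * u * F s + 2 * \<gamma> * P - A' * F x + A * F x
        - A' * (norm (G x))\<^sup>2 / 2 + A * (norm (G x))\<^sup>2 / 2
        + 2 * u * (G x \<bullet> (x - s)) + 2 * \<gamma> * (G x \<bullet> (x - p)) + 2 * \<gamma> * (G p \<bullet> G x)"
    unfolding interp_gap_def P_def A'A Gs power2_norm_eq_inner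
    by (simp add: inner_diff_left inner_diff_right inner_commute algebra_simps
        add_divide_distrib diff_divide_distrib)
  have 4: "2 * w * (1 - b) * F s - 2 * w * (1 - a) * F s = 2 * u * F s"
    by (simp add: u_def algebra_simps)
  have 5: "w * (1 / b + b - 2) * P - w * (1 / a + a - 2) * P = 2 * \<gamma> * P"
    unfolding sc(4) by (simp add: algebra_simps)
  have 6: "A * (F x + (norm (G x))\<^sup>2 / 2 - (x - y) \<bullet> G x)
      = A * F x + A * (norm (G x))\<^sup>2 / 2 - A * ((x - y) \<bullet> G x)"
    by (simp add: algebra_simps)
  show "energy F G w s p b x' y' z' - energy F G w s p a x y z
      = 2 * u * interp_gap F G s x + w * (1 / b - b) * interp_gap F G x x'
        + 2 * \<gamma> * interp_gap F G p x"
    using 1 2 3 4 5 6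
    unfolding energy_def A_def[symmetric] A'_def[symmetric] P_def[symmetric]
    by linarith
qed

text \<open>
  With \<open>w a = 1\<close> and \<open>x = y = p\<close> the products of \<open>z\<close> with \<open>G p\<close> cancel.
\<close>

lemma energy_final:
  assumes "w * a = 1" "a \<noteq> 0"
  shows "energy F G w s p a p p z
    = 2 * (w - 1) * (F s - F p) - (w\<^sup>2 - w) * (norm (G p))\<^sup>2 - (norm (p - s))\<^sup>2"
proof -
  have "1 / a = w" using assms by (simp add: field_simps)
  have scalars: "w * (w + a - 2) = w\<^sup>2 + 1 - 2 * w" "w * (w - a) = w\<^sup>2 - 1"
    "2 * w * (1 - a) = 2 * w - 2" "2 * w * a = 2"
    using assms by (simp_all add: power2_eq_square algebra_simps)
  show ?thesis
    unfolding energy_def \<open>1 / a = w\<close> scalars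
    by (simp add: inner_diff_right algebra_simps add_divide_distrib diff_divide_distrib)
qed

text \<open>
  The gap between \<open>p\<close> and \<open>s\<close> gives \<open>F p - F s \<ge> (norm (G p))\<^sup>2 / 2\<close>, and together with the reversed
  gap it gives \<open>norm (G p) \<le> norm (p - s)\<close>. These replace the terms of the final energy other than
  \<open>(norm (G p))\<^sup>2\<close>; the coefficients add up to \<open>(w - 1) + (w\<^sup>2 - w) + 1 = w\<^sup>2\<close>.
\<close>

lemma final_gradient_bound:
  assumes gap: "\<And>x y. 0 \<le> interp_gap F G x y" and Gs: "G s = 0"
    and w: "1 \<le> w"
    and energy: "2 * (w - 1) * (F s - F p) - (w\<^sup>2 - w) * (norm (G p))\<^sup>2 - (norm (p - s))\<^sup>2 \<ge> - R"
  shows "w\<^sup>2 * (norm (G p))\<^sup>2 \<le> R"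
proof -
  have F: "(norm (G p))\<^sup>2 / 2 \<le> F p - F s"
    using gap[of p s] Gs by (simp add: interp_gap_def)
  have "(norm (G p))\<^sup>2 \<le> G p \<bullet> (p - s)"
    using F gap[of s p] Gs by (simp add: interp_gap_def inner_diff_right)
  also have "\<dots> \<le> norm (G p) * norm (p - s)"
    by (rule norm_cauchy_schwarz)
  finally have "norm (G p) \<le> norm (p - s)"
    by (cases "G p = 0") (auto simp: power2_eq_square)
  then have "(norm (G p))\<^sup>2 \<le> (norm (p - s))\<^sup>2"
    by simp
  moreover have "(w - 1) * ((norm (G p))\<^sup>2 / 2) \<le> (w - 1) * (F p - F s)"
    using F w by (intro mult_left_mono) auto
  moreover have "2 * (w - 1) * (F s - F p) = - 2 * ((w - 1) * (F p - F s))"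
    and "(w\<^sup>2 - w) * (norm (G p))\<^sup>2
      = w\<^sup>2 * (norm (G p))\<^sup>2 - 2 * ((w - 1) * ((norm (G p))\<^sup>2 / 2)) - (norm (G p))\<^sup>2"
    by (simp_all add: field_simps)
  ultimately show ?thesis
    using energy by linarith
qed

text \<open>
  The gaps are nonnegative with nonnegative weights, so the energy does not decrease along the
  iteration; its initial value is attained at \<open>y = x0\<close>. The existentially quantified \<open>y\<close> is the
  accumulation \<open>x0 - (\<Sum>i<k. u\<^sub>i g\<^sub>i)\<close>.
\<close>

lemma agm_energy:
  fixes f :: "'a::euclidean_space \<Rightarrow> real" and L :: real
  defines "F \<equiv> \<lambda>x. f x / L" and "G \<equiv> \<lambda>x. (1 / L) *\<^sub>R gradient f x"
  assumes gap: "\<And>x y. 0 \<le> interp_gap F G x y" and Gs: "G s = 0" and k: "k \<le> N"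
  shows "\<exists>y. agm_x N L f x0 k
        = y - (2 * (rho N (k + 1))\<^sup>2 / (1 - (rho N (k + 1))\<^sup>2)) *\<^sub>R agm_z N L f x0 k \<and>
      - (norm (x0 - s))\<^sup>2
        \<le> energy F G (Omega N) s p (rho N k) (agm_x N L f x0 k) y (agm_z N L f x0 k)"
  using k
proof (induction k)
  case 0
  have "rho N 0 = 1"
    using Omega_rho(2)[of N] by (simp add: lemniscate_seq_def)
  then show ?case
    by (intro exI[of _ x0]) (simp add: energy_def)
next
  case (Suc k)
  define w a b c where "w = Omega N" and "a = rho N k" and "b = rho N (k + 1)"
    and "c = rho N (k + 2)"
  define x z x' z' where "x = agm_x N L f x0 k" and "z = agm_z N L f x0 k"
    and "x' = agm_x N L f x0 (Suc k)" and "z' = agm_z N L f x0 (Suc k)"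
  define u \<gamma> q where "u = w * (a - b)"
    and "\<gamma> = w * ((1 + b\<^sup>2) / (2 * b) - (1 + a\<^sup>2) / (2 * a))"
    and "q = 2 * b\<^sup>2 / (1 - b\<^sup>2)"
  have seq: "lemniscate_seq N w (rho N)" "0 < w"
    using Omega_rho by (simp_all add: w_def)
  have eq: "w * (a - b)\<^sup>2 = a * (1 - b\<^sup>2)" and ba: "b < a" and cb: "c < b" and c: "0 \<le> c"
    using seq(1) Suc.prems by (auto simp: lemniscate_seq_def a_def b_def c_def)
  have b: "0 < b" "a \<le> 1"
    using c cb lemniscate_seq_eq_iter[OF seq, of k] Suc.prems by (auto simp: a_def)
  \<comment> \<open>Puts the step coefficients of the method into the form of \<open>q\<close>.\<close>
  have c_form: "(1 + t\<^sup>2) / (1 - t\<^sup>2) = 1 + 2 * t\<^sup>2 / (1 - t\<^sup>2)" if "0 \<le> t" "t < 1" for t :: real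
  proof -
    have "t\<^sup>2 < 1"
      using that by (simp add: power2_less_1_iff)
    then show ?thesis by (simp add: field_simps)
  qed
  obtain y where y: "x = y - q *\<^sub>R z"
    and en: "- (norm (x0 - s))\<^sup>2 \<le> energy F G w s p a x y z"
    using Suc by (auto simp: x_def z_def q_def w_def a_def b_def)
  define y' where "y' = y - u *\<^sub>R G x"
  have z': "z' = z - \<gamma> *\<^sub>R G x"
    by (simp add: z'_def z_def \<gamma>_def w_def a_def b_def G_def x_def)
  note step = energy_step[where G = G and y = y and z = z, 
      OF eq b(1) ba b(2) Gs y[unfolded q_def], folded u_def \<gamma>_def q_def,
      folded z' y'_def]
  have "x' = x - G x + ((1 + b\<^sup>2) / (1 - b\<^sup>2) - (1 + c\<^sup>2) / (1 - c\<^sup>2)) *\<^sub>R z'"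
    by (simp add: x'_def x_def z'_def b_def c_def G_def gradient_step_def del: agm_z.simps)
  also have "(1 + b\<^sup>2) / (1 - b\<^sup>2) - (1 + c\<^sup>2) / (1 - c\<^sup>2) = q - 2 * c\<^sup>2 / (1 - c\<^sup>2)"
    using b ba cb c by (simp add: c_form q_def)
  finally have x': "x' = y' - (2 * c\<^sup>2 / (1 - c\<^sup>2)) *\<^sub>R z'"
    using step(1) by (simp add: algebra_simps)
  have "0 \<le> u"
    using seq ba by (simp add: u_def)
  moreover have "0 \<le> w * (1 / b - b)"
  proof -
    have "b * b \<le> 1"
      using b ba by (intro mult_le_one) auto
    then have "b \<le> 1 / b"
      using b by (simp add: field_simps)
    then show ?thesis
      using seq by simp
  qed
  moreover have "0 \<le> \<gamma>"
  proof -
    have "(1 + b\<^sup>2) / (2 * b) - (1 + a\<^sup>2) / (2 * a) = (a - b) * (1 - a * b) / (2 * a * b)"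
      using b ba by (simp add: field_simps power2_eq_square)
    moreover have "a * b \<le> 1"
      using b ba by (intro mult_le_one) auto
    ultimately show ?thesis
      using b ba seq by (simp add: \<gamma>_def)
  qed
  ultimately have "0 \<le> 2 * u * interp_gap F G s x
      + w * (1 / b - b) * interp_gap F G x x' + 2 * \<gamma> * interp_gap F G p x"
    using gap by simp
  then have "- (norm (x0 - s))\<^sup>2 \<le> energy F G w s p b x' y' z'"
    using en step(2)[of F p x'] by linarith
  then show ?case
    using x' by (intro exI[of _ y'])
      (simp add: x'_def z'_def w_def b_def c_def del: agm_x.simps agm_z.simps)
qed

section \<open>The convergence rate\<close>

theorem theorem1:
  fixes f :: "real ^ 'd \<Rightarrow> real" and x0 xs :: "real ^ 'd" and L :: real and N :: nat
  assumes "1 \<le> N"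
    and "0 < L"
    and "smooth L f"
    and "convex_on UNIV f"
    and "\<forall>x. f xs \<le> f x"
  shows "(norm (gradient f (agm_x N L f x0 N)))\<^sup>2 \<le> L\<^sup>2 * (norm (x0 - xs))\<^sup>2 / (Omega N)\<^sup>2 \<and>
         L\<^sup>2 * (norm (x0 - xs))\<^sup>2 / (Omega N)\<^sup>2
           \<le> lemniscate_const ^ 4 * L\<^sup>2 * (norm (x0 - xs))\<^sup>2 / (real (N + 1)) ^ 4"
proof
  define w p where "w = Omega N" and "p = agm_x N L f x0 N"
  define F where "F x = f x / L" for x
  define G where "G x = (1 / L) *\<^sub>R gradient f x" for x
  have seq: "lemniscate_seq N w (rho N)" "0 < w"
    using Omega_rho by (simp_all add: w_def)
  have Gs: "G xs = 0"
    using gradient_minimizer_eq_0[OF assms(3,2,5)] by (simp add: G_def)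
  have gap: "0 \<le> interp_gap F G x y" for x y
  proof -
    have "(f y + gradient f y \<bullet> (x - y)
        + (norm (gradient f x - gradient f y))\<^sup>2 / (2 * L)) / L \<le> f x / L"
      by (intro divide_right_mono convex_smooth_interpolation assms less_imp_le)
    moreover have "(norm (G x - G y))\<^sup>2 / 2 = (norm (gradient f x - gradient f y))\<^sup>2 / (2 * L) / L"
      using \<open>0 < L\<close>
      by (simp add: G_def power_divide power2_eq_square flip: scaleR_diff_right)
    ultimately show ?thesis
      by (simp add: interp_gap_def F_def G_def add_divide_distrib)
  qed
  have rho: "rho N (N + 1) = 0" "0 < rho N N" "rho N N \<le> 1"
    "w * (rho N N)\<^sup>2 = rho N N"
    using seq(1) lemniscate_seq_eq_iter[OF seq, of N] by (auto simp: lemniscate_seq_def)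
  then have inv: "w * rho N N = 1"
    by (simp add: power2_eq_square)
  then have "1 \<le> w"
    using rho(2,3) seq(2) by (metis mult_left_le less_imp_le)
  obtain y where "p = y" "- (norm (x0 - xs))\<^sup>2 \<le> energy F G w xs p (rho N N) p y (agm_z N L f x0 N)"
    using agm_energy[of f L xs N N x0 p, folded F_def G_def] gap Gs rho(1)
    by (auto simp: w_def p_def)
  then have "w\<^sup>2 * (norm (G p))\<^sup>2 \<le> (norm (x0 - xs))\<^sup>2"
    using inv rho(2) \<open>1 \<le> w\<close> gap Gs
    by (intro final_gradient_bound[where F = F and s = xs]) (auto simp: energy_final)
  then show "(norm (gradient f p))\<^sup>2 \<le> L\<^sup>2 * (norm (x0 - xs))\<^sup>2 / (Omega N)\<^sup>2"
    using \<open>0 < L\<close> seq(2) unfolding w_def[symmetric]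
    by (simp add: G_def power_divide field_simps)
  have "real (N + 1) ^ 4 \<le> (sqrt w * lemniscate_const) ^ 4"
    by (intro power_mono lemniscate_seq_lower[OF seq]) simp
  also have "\<dots> = w\<^sup>2 * lemniscate_const ^ 4"
    using seq(2) by (simp add: power_mult_distrib sqrt_power4)
  finally have "1 / w\<^sup>2 \<le> lemniscate_const ^ 4 / real (N + 1) ^ 4"
    using seq(2) by (simp add: field_simps)
  then have "L\<^sup>2 * (norm (x0 - xs))\<^sup>2 * (1 / w\<^sup>2)
      \<le> L\<^sup>2 * (norm (x0 - xs))\<^sup>2 * (lemniscate_const ^ 4 / real (N + 1) ^ 4)"
    by (intro mult_left_mono) auto
  then show "L\<^sup>2 * (norm (x0 - xs))\<^sup>2 / (Omega N)\<^sup>2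
      \<le> lemniscate_const ^ 4 * L\<^sup>2 * (norm (x0 - xs))\<^sup>2 / (real (N + 1)) ^ 4"
    by (simp add: w_def mult.commute mult.left_commute)
qed

end
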